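(* Let $n=2$, let $m$ be a positive integer and set $t=q^m$. Then the first eigenfunction $f_0(\zeta_1,\zeta_2)$ becomes terminating, in the sense that $$\zeta_1^{m}f_0(\zeta_1,\zeta_2)\in{\cal P}_2,$$ and this polynomial is antisymmetric with respect to the Weyl group action $\pi_m$: $$\pi_m(\sigma_1)\cdot \zeta_1^mf_0(\zeta_1,\zeta_2)=-\,\zeta_1^mf_0(\zeta_1,\zeta_2),$$ where $\sigma_1$ is the generator of $W(A_1)$.
   Context: $q$ is a generic parameter (nonzero, not a root of unity); $s_1,s_2$ are independent variables. ${\cal P}_n$ is the space of polynomials in $\zeta_1,\dots,\zeta_n$ with coefficients in the field of rational functions in $s_1,\dots,s_n$. Weyl group action: $W(A_{n-1})$ is generated by $\sigma_1,\dots,\sigma_{n-1}$; for a positive integer $m$, $\pi_m(\sigma_i)$ acts on ${\cal P}_n$ by $$\pi_m(\sigma_i)f=\prod_{k=1}^{m-1}\frac{s_i-q^ks_{i+1}}{s_{i+1}-q^ks_i}\cdot f\big|_{\zeta_i\leftrightarrow\zeta_{i+1},\ s_i\leftrightarrow s_{i+1}} .$$ First eigenfunction: let $$D=D(s_1,s_2;q,t)=s_1\theta_+(\zeta_2/\zeta_1)T_{q^{-1},\zeta_1}+s_2\theta_-(\zeta_2/\zeta_1)T_{q^{-1},\zeta_2},\qquad \theta_\pm(\zeta)=\frac{1-q^{\pm1}t^{\mp1}\zeta}{1-q^{\pm1}\zeta}\ \text{(as power series in }\zeta),$$ with $T_{x,\zeta_i}$ replacing $\zeta_i$ by $x\zeta_i$.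 $f_0$ is the unique formal power series in $\zeta_2/\zeta_1$ with constant term $1$ satisfying $Df_0=(s_1+s_2)f_0$; explicitly $$f_0(\zeta_1,\zeta_2)=(1-\zeta_2/\zeta_1)\sum_{k\ge0}\frac{(qt^{-1};q)_k(qt^{-1}s_1/s_2;q)_k}{(q;q)_k(qs_1/s_2;q)_k}(t\zeta_2/\zeta_1)^k,\qquad (a;q)_k=\prod_{i=0}^{k-1}(1-aq^i).$$ (For $n=2$ this same series is the first eigenfunction of the integral transformation $I(\alpha)$ of the paper.) *)

theory Defs
  imports "HOL-Computational_Algebra.Computational_Algebra"
begin

section \<open>Substitution into bivariate polynomials\<close>

text \<open>A bivariate polynomial is an element of \<open>'b poly poly\<close>; the inner variable is the first
  one and the outer variable is the second one, so \<open>coeff (coeff p j) i\<close> is the coefficient of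
  \<open>x\<^sub>1\<^sup>i x\<^sub>2\<^sup>j\<close>.\<close>

definition var1 :: "'b::comm_ring_1 poly poly" where
  "var1 = [:[:0, 1:]:]"

definition var2 :: "'b::comm_ring_1 poly poly" where
  "var2 = [:0, 1:]"

definition const2 :: "'b::comm_ring_1 \<Rightarrow> 'b poly poly" where
  "const2 c = [:[:c:]:]"

text \<open>Apply \<open>h\<close> to the coefficients and substitute \<open>x\<close> and \<open>y\<close> for the first and second variable.\<close>

definition subst2 :: "('b::zero \<Rightarrow> 'c::comm_ring_1) \<Rightarrow> 'c \<Rightarrow> 'c \<Rightarrow> 'b poly poly \<Rightarrow> 'c" where
  "subst2 h x y p = poly (map_poly (\<lambda>c. poly (map_poly h c) x) p) y"

definition swap_vars :: "('b::zero \<Rightarrow> 'c::comm_ring_1) \<Rightarrow> 'b poly poly \<Rightarrow> 'c poly poly" where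
  "swap_vars h p = subst2 (\<lambda>c. const2 (h c)) var2 var1 p"

lemma subst2_0 [simp]: "subst2 h x y 0 = 0"
  by (simp add: subst2_def)

lemma subst2_pCons:
  assumes "h 0 = 0"
  shows "subst2 h x y (pCons a p) = poly (map_poly h a) x + y * subst2 h x y p"
  by (simp add: subst2_def map_poly_pCons)

lemma coeff_poly_const2_var2:
  assumes "h 0 = 0"
  shows "coeff (coeff (poly (map_poly (\<lambda>c. const2 (h c)) a) var2) i) j
           = (if j = 0 then h (coeff a i) else 0)"
proof (induction a arbitrary: i)
  case 0
  then show ?case using assms by simp
next
  case (pCons c a)
  then show ?case using assms
    by (cases i; cases j)
       (auto simp: map_poly_pCons const2_def var2_def coeff_pCons split: nat.splits)
qed

lemma coeff_swap_vars:
  assumes "h 0 = 0"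
  shows "coeff (coeff (swap_vars h p) i) j = h (coeff (coeff p j) i)"
proof (induction p arbitrary: j)
  case 0
  then show ?case using assms by (simp add: swap_vars_def)
next
  case (pCons a p)
  have "swap_vars h (pCons a p)
          = poly (map_poly (\<lambda>c. const2 (h c)) a) var2 + var1 * swap_vars h p"
    using assms by (simp add: swap_vars_def subst2_pCons const2_def)
  then show ?case using pCons assms
    by (cases j) (auto simp: coeff_poly_const2_var2 var1_def coeff_pCons)
qed

lemma swap_vars_id_mult:
  fixes p r :: "'b::comm_ring_1 poly poly"
  shows "swap_vars (\<lambda>c. c) (p * r) = swap_vars (\<lambda>c. c) p * swap_vars (\<lambda>c. c) r"
proof (intro poly_eqI)
  fix i j
  have "coeff (coeff (p * r) j) i
          = (\<Sum>l\<le>j. \<Sum>k\<le>i. coeff (coeff p l) k * coeff (coeff r (j - l)) (i - k))"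
    by (simp add: coeff_mult coeff_sum)
  also have "\<dots> = (\<Sum>k\<le>i. \<Sum>l\<le>j. coeff (coeff p l) k * coeff (coeff r (j - l)) (i - k))"
    by (rule sum.swap)
  finally show "coeff (coeff (swap_vars (\<lambda>c. c) (p * r)) i) j
       = coeff (coeff (swap_vars (\<lambda>c. c) p * swap_vars (\<lambda>c. c) r) i) j"
    by (simp add: coeff_swap_vars coeff_mult coeff_sum)
qed

lemma swap_vars_id_eq_0_iff:
  fixes p :: "'b::comm_ring_1 poly poly"
  shows "swap_vars (\<lambda>c. c) p = 0 \<longleftrightarrow> p = 0"
  by (auto simp: poly_eq_iff coeff_swap_vars)


section \<open>The coefficient field and the polynomial space\<close>

text \<open>\<open>'a ratfun\<close> is the field of rational functions in \<open>s\<^sub>1\<close>, \<open>s\<^sub>2\<close> over the ground field \<open>'a\<close>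
  (which contains \<open>q\<close>), and \<open>'a polyspace\<close> is \<open>\<P>\<^sub>2\<close>, the polynomials in \<open>\<zeta>\<^sub>1\<close>, \<open>\<zeta>\<^sub>2\<close> over it.\<close>

type_synonym 'a ratfun = "'a poly poly fract"
type_synonym 'a polyspace = "'a ratfun poly poly"

definition s1 :: "'a::field ratfun" where
  "s1 = to_fract var1"

definition s2 :: "'a::field ratfun" where
  "s2 = to_fract var2"

definition scalar :: "'a::field \<Rightarrow> 'a ratfun" where
  "scalar c = to_fract (const2 c)"

text \<open>The automorphism of the coefficient field that exchanges \<open>s\<^sub>1\<close> and \<open>s\<^sub>2\<close>.\<close>

definition swap_s :: "'a::field ratfun \<Rightarrow> 'a ratfun" where
  "swap_s r = (THE y. \<exists>a b. b \<noteq> 0 \<and> r = Fract a b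
                 \<and> y = Fract (swap_vars (\<lambda>c. c) a) (swap_vars (\<lambda>c. c) b))"

lemma swap_s_Fract:
  assumes "b \<noteq> 0"
  shows "swap_s (Fract a b) = Fract (swap_vars (\<lambda>c. c) a) (swap_vars (\<lambda>c. c) b)"
  unfolding swap_s_def
proof (rule the_equality)
  fix y assume "\<exists>a' b'. b' \<noteq> 0 \<and> Fract a b = Fract a' b'
                 \<and> y = Fract (swap_vars (\<lambda>c. c) a') (swap_vars (\<lambda>c. c) b')"
  then obtain a' b' where *: "b' \<noteq> 0" "Fract a b = Fract a' b'"
    "y = Fract (swap_vars (\<lambda>c. c) a') (swap_vars (\<lambda>c. c) b')" by blast
  then have "a * b' = a' * b" using assms by (simp add: eq_fract)
  then show "y = Fract (swap_vars (\<lambda>c. c) a) (swap_vars (\<lambda>c. c) b)"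
    using * assms by (simp add: eq_fract swap_vars_id_eq_0_iff flip: swap_vars_id_mult)
qed (use assms in blast)

text \<open>\<open>\<pi>\<^sub>m(\<sigma>\<^sub>1)\<close>; here \<open>swap_vars swap_s\<close> exchanges \<open>\<zeta>\<^sub>1\<close> with \<open>\<zeta>\<^sub>2\<close> and \<open>s\<^sub>1\<close> with \<open>s\<^sub>2\<close>.\<close>

definition pi_sigma1 :: "'a::field \<Rightarrow> nat \<Rightarrow> 'a polyspace \<Rightarrow> 'a polyspace" where
  "pi_sigma1 q m f =
     const2 (\<Prod>k = 1..m - 1. (s1 - scalar q ^ k * s2) / (s2 - scalar q ^ k * s1))
       * swap_vars swap_s f"


section \<open>Formal series in two variables\<close>

text \<open>Both \<open>\<P>\<^sub>2\<close> and \<open>K[[\<zeta>\<^sub>2/\<zeta>\<^sub>1]]\<close> are viewed inside the ring \<open>K((\<zeta>\<^sub>1\<^sup>-\<^sup>1))[[\<zeta>\<^sub>2]]\<close>: the variable of the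
  inner Laurent series is \<open>\<zeta>\<^sub>1\<^sup>-\<^sup>1\<close>, the variable of the outer power series is \<open>\<zeta>\<^sub>2\<close>.\<close>

type_synonym 'k series2 = "'k fls fps"

definition zeta1 :: "'k::field series2" where
  "zeta1 = fps_const fls_X_inv"

definition zeta2 :: "'k::field series2" where
  "zeta2 = fps_X"

definition zeta2_over_zeta1 :: "'k::field series2" where
  "zeta2_over_zeta1 = fps_const fls_X * zeta2"

lemma zeta1_times_zeta2_over_zeta1: "zeta1 * zeta2_over_zeta1 = (zeta2 :: 'k::field series2)"
  by (simp add: zeta1_def zeta2_over_zeta1_def fls_X_times_conv_shift fls_X_inv_times_conv_shift
      flip: mult.assoc)

definition poly_to_series2 :: "'k::field poly poly \<Rightarrow> 'k series2" where
  "poly_to_series2 p = subst2 (\<lambda>c. fps_const (fls_const c)) zeta1 zeta2 p"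

definition ratio_series :: "'k::field fps \<Rightarrow> 'k series2" where
  "ratio_series f = Abs_fps (\<lambda>k. fls_const (fps_nth f k)) oo zeta2_over_zeta1"

lemma coeff_poly_zeta1:
  fixes a :: "'k::field poly"
  shows "fls_nth (fps_nth (poly (map_poly (\<lambda>c. fps_const (fls_const c)) a) zeta1) j) (- int i)
           = (if j = 0 then coeff a i else 0)"
proof (induction a arbitrary: i)
  case 0
  then show ?case by simp
next
  case (pCons c a)
  show ?case
  proof (cases i)
    case 0
    have "fls_nth (fps_nth (poly (map_poly (\<lambda>c. fps_const (fls_const c)) a) zeta1) j) 1 = 0"
    proof -
      have "fls_nth (fps_nth (poly (map_poly (\<lambda>c. fps_const (fls_const c)) b) zeta1) j) n = 0"
        if "n > 0" for n and b :: "'k poly"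
        using that
      proof (induction b arbitrary: n)
        case (pCons c b)
        then show ?case
          by (simp add: map_poly_pCons zeta1_def fls_X_inv_times_conv_shift)
      qed simp
      then show ?thesis by simp
    qed
    with 0 show ?thesis
      by (simp add: map_poly_pCons zeta1_def fls_X_inv_times_conv_shift)
  next
    case (Suc i')
    with pCons.IH[of i'] show ?thesis
      by (simp add: map_poly_pCons zeta1_def fls_X_inv_times_conv_shift)
  qed
qed

lemma coeff_poly_to_series2:
  "fls_nth (fps_nth (poly_to_series2 p) j) (- int i) = coeff (coeff p j) i"
proof (induction p arbitrary: j)
  case 0
  then show ?case by (simp add: poly_to_series2_def)
next
  case (pCons a p)
  have "poly_to_series2 (pCons a p)
     = poly (map_poly (\<lambda>c. fps_const (fls_const c)) a) zeta1 + zeta2 * poly_to_series2 p"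
    by (simp add: poly_to_series2_def subst2_pCons)
  then show ?case using pCons
    by (cases j) (auto simp: coeff_poly_zeta1 zeta2_def)
qed

lemma inj_poly_to_series2: "inj poly_to_series2"
  by (rule injI) (metis coeff_poly_to_series2 poly_eqI)

lemma ratio_series_nth:
  "fps_nth (ratio_series f) k = fls_const (fps_nth f k) * fls_X ^ k"
  by (simp add: ratio_series_def zeta2_over_zeta1_def zeta2_def)


section \<open>The first eigenfunction\<close>

text \<open>A series in \<open>x = \<zeta>\<^sub>2/\<zeta>\<^sub>1\<close> is represented by its \<open>fps\<close> in \<open>x\<close>. Replacing \<open>\<zeta>\<^sub>2\<close> by \<open>c \<zeta>\<^sub>2\<close> means
  replacing \<open>x\<close> by \<open>c x\<close>, and replacing \<open>\<zeta>\<^sub>1\<close> by \<open>c \<zeta>\<^sub>1\<close> means replacing \<open>x\<close> by \<open>c\<^sup>-\<^sup>1 x\<close>.\<close>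

definition T_zeta1 :: "'k::field \<Rightarrow> 'k fps \<Rightarrow> 'k fps" where
  "T_zeta1 c f = f oo (fps_const (inverse c) * fps_X)"

definition T_zeta2 :: "'k::field \<Rightarrow> 'k fps \<Rightarrow> 'k fps" where
  "T_zeta2 c f = f oo (fps_const c * fps_X)"

definition theta_plus :: "'k::field \<Rightarrow> 'k \<Rightarrow> 'k fps" where
  "theta_plus q t = (1 - fps_const (q * inverse t) * fps_X) / (1 - fps_const q * fps_X)"

definition theta_minus :: "'k::field \<Rightarrow> 'k \<Rightarrow> 'k fps" where
  "theta_minus q t = (1 - fps_const (inverse q * t) * fps_X) / (1 - fps_const (inverse q) * fps_X)"

definition D_op :: "'k::field \<Rightarrow> 'k \<Rightarrow> 'k \<Rightarrow> 'k \<Rightarrow> 'k fps \<Rightarrow> 'k fps" where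
  "D_op a b q t f =
     fps_const a * theta_plus q t * T_zeta1 (inverse q) f
       + fps_const b * theta_minus q t * T_zeta2 (inverse q) f"

definition is_first_eigenfunction :: "'k::field \<Rightarrow> 'k \<Rightarrow> 'k \<Rightarrow> 'k \<Rightarrow> 'k fps \<Rightarrow> bool" where
  "is_first_eigenfunction a b q t f \<longleftrightarrow>
     fps_nth f 0 = 1 \<and> D_op a b q t f = fps_const (a + b) * f"

text \<open>Existence and uniqueness, under the genericity conditions, are shown below together with
  the explicit formula.\<close>

definition first_eigenfunction :: "'k::field \<Rightarrow> 'k \<Rightarrow> 'k \<Rightarrow> 'k \<Rightarrow> 'k fps" where
  "first_eigenfunction a b q t = (THE f. is_first_eigenfunction a b q t f)"

definition qpoch :: "'k::field \<Rightarrow> 'k \<Rightarrow> nat \<Rightarrow> 'k" where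
  "qpoch a q k = (\<Prod>i<k. 1 - a * q ^ i)"

definition explicit_series :: "'k::field \<Rightarrow> 'k \<Rightarrow> 'k \<Rightarrow> 'k \<Rightarrow> 'k fps" where
  "explicit_series a b q t =
     (1 - fps_X) * Abs_fps (\<lambda>k. qpoch (q * inverse t) q k * qpoch (q * inverse t * a / b) q k
        / (qpoch q q k * qpoch (q * a / b) q k) * t ^ k)"

lemma is_first_eigenfunction_iff:
  fixes a b q t :: "'k::field"
  assumes "q \<noteq> 0" "t \<noteq> 0" "b \<noteq> 0"
    and q_generic: "\<And>k. k > 0 \<Longrightarrow> q ^ k \<noteq> 1"
    and ab_generic: "\<And>k. k > 0 \<Longrightarrow> b \<noteq> q ^ k * a"
  shows "is_first_eigenfunction a b q t f \<longleftrightarrow> f = explicit_series a b q t"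
proof -
  define c where "c = (\<lambda>k. qpoch (q * inverse t) q k * qpoch (q * inverse t * a / b) q k
        / (qpoch q q k * qpoch (q * a / b) q k) * t ^ k)"
  define U where "U = 1 - fps_const q * fps_X"
  define V where "V = 1 - fps_const (inverse q) * fps_X"
  define g where "g = f * inverse (1 - fps_X)"
  have [simp]: "fps_nth U 0 = 1" "fps_nth V 0 = 1"
    by (simp_all add: U_def V_def)
  have nz: "U \<noteq> 0" "V \<noteq> 0"
    by (metis \<open>fps_nth U 0 = 1\<close> fps_zero_nth zero_neq_one)
       (metis \<open>fps_nth V 0 = 1\<close> fps_zero_nth zero_neq_one)
  have f_eq: "f = (1 - fps_X) * g"
    by (simp add: g_def inverse_mult_eq_1' mult.left_commute)
  define gp where "gp = g oo (fps_const q * fps_X)"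
  define gm where "gm = g oo (fps_const (inverse q) * fps_X)"
  have comp: "f oo (fps_const d * fps_X)
      = (1 - fps_const d * fps_X) * (g oo (fps_const d * fps_X))" for d
    by (simp add: f_eq fps_compose_mult_distrib fps_compose_sub_distrib)
  have divU: "x / U * (U * y) = x * y" for x y
    by (simp add: fps_divide_unit inverse_mult_eq_1 mult_ac)
       (metis \<open>fps_nth U 0 = 1\<close> inverse_mult_eq_1 mult.left_commute mult.right_neutral zero_neq_one)
  have divV: "x / V * (V * y) = x * y" for x y
    by (simp add: fps_divide_unit inverse_mult_eq_1 mult_ac)
       (metis \<open>fps_nth V 0 = 1\<close> inverse_mult_eq_1 mult.left_commute mult.right_neutral zero_neq_one)
  have D: "D_op a b q t f = fps_const a * (1 - fps_const (q * inverse t) * fps_X) * gp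
       + fps_const b * (1 - fps_const (inverse q * t) * fps_X) * gm"
    unfolding D_op_def theta_plus_def theta_minus_def T_zeta1_def T_zeta2_def comp inverse_inverse_eq
      U_def[symmetric] V_def[symmetric] gp_def[symmetric] gm_def[symmetric]
    by (simp only: mult.assoc divU divV)
  define A where "A = (\<lambda>k. (q ^ k - 1) * (a - b * inverse q ^ k))"
  define u where "u = (\<lambda>k. q ^ k * inverse t)"
  define B where "B = (\<lambda>k. (u k - 1) * (a - b * inverse (u k)))"
  have u_nz: "u k \<noteq> 0" for k using assms by (simp add: u_def)
  have diff: "fps_nth (D_op a b q t f - fps_const (a + b) * f) k
     = (if k = 0 then 0 else A k * fps_nth g k - B k * fps_nth g (k - 1))" for k
  proof (cases k)
    case 0
    then show ?thesis unfolding D unfolding f_eq gp_def gm_def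
      by (simp add: algebra_simps)
  next
    case (Suc n)
    have 1: "A k = a * q ^ k + b * inverse q ^ k - (a + b)"
      using assms(1) by (simp add: A_def field_simps)
    have 2: "B k = a * (q * inverse t) * q ^ n + b * (inverse q * t) * inverse q ^ n - (a + b)"
      using assms(1,2) u_nz[of k] by (simp add: B_def u_def Suc field_simps)
    show ?thesis unfolding D unfolding f_eq gp_def gm_def 1 2
      by (simp add: Suc ring_distribs mult.assoc mult.left_commute[of fps_X] fps_mult_left_const_nth)
  qed
  have A_nz: "A k \<noteq> 0" if "k > 0" for k
  proof
    assume "A k = 0"
    then have "a = b * inverse q ^ k" using q_generic[OF that] by (simp add: A_def)
    then have "b = q ^ k * a" using assms(1) by (simp add: power_inverse)
    then show False using ab_generic[OF that] by simp
  qed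
  have c_Suc: "A (Suc n) * c (Suc n) = B (Suc n) * c n" for n
  proof -
    define w where "w = q * q ^ n"
    define N1 where "N1 = 1 - q * inverse t * q ^ n"
    define N2 where "N2 = 1 - q * inverse t * a / b * q ^ n"
    define M1 where "M1 = 1 - q * q ^ n"
    define M2 where "M2 = 1 - q * a / b * q ^ n"
    have w: "w \<noteq> 0" using assms(1) by (simp add: w_def)
    have qp: "qpoch x q (Suc n) = qpoch x q n * (1 - x * q ^ n)" for x
      by (simp add: qpoch_def)
    have d1: "M1 \<noteq> 0" using q_generic[of "Suc n"] by (simp add: M1_def)
    have d2: "M2 \<noteq> 0"
      using ab_generic[of "Suc n"] assms(3) by (auto simp: M2_def field_simps)
    have "c (Suc n) = c n * (t * N1 * N2 / (M1 * M2))"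
    proof -
      have *: "(x1 * N1) * (x2 * N2) / ((y1 * M1) * (y2 * M2)) * (t * z)
          = x1 * x2 / (y1 * y2) * z * (t * N1 * N2 / (M1 * M2))" for x1 x2 y1 y2 z
        by (simp add: mult_ac)
      show ?thesis
        unfolding c_def qp power_Suc N1_def[symmetric] N2_def[symmetric]
          M1_def[symmetric] M2_def[symmetric] by (rule *)
    qed
    moreover have "A (Suc n) = M1 * M2 * (b / w)"
    proof -
      have "(w - 1) * (a - b * inverse w) = (1 - w) * (1 - w * (a / b)) * (b / w)"
        using w assms(3) by (simp add: divide_simps) (simp add: algebra_simps)
      then show ?thesis by (simp add: A_def M1_def M2_def w_def power_inverse mult_ac)
    qed
    moreover have "B (Suc n) = t * N1 * N2 * (b / w)"
    proof -
      have "(w * inverse t - 1) * (a - b * inverse (w * inverse t))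
          = t * (1 - w * inverse t) * (1 - w * inverse t * (a / b)) * (b / w)"
        using w assms(2,3) by (simp add: divide_simps) (simp add: algebra_simps)
      moreover have "N1 = 1 - w * inverse t" "N2 = 1 - w * inverse t * (a / b)"
        by (simp_all add: N1_def N2_def w_def mult_ac)
      moreover have "B (Suc n) = (w * inverse t - 1) * (a - b * inverse (w * inverse t))"
        by (simp add: B_def u_def w_def)
      ultimately show ?thesis by simp
    qed
    ultimately show ?thesis using d1 d2 by (simp add: mult_ac)
  qed
  have "is_first_eigenfunction a b q t f \<longleftrightarrow>
      fps_nth g 0 = 1 \<and> (\<forall>n. A (Suc n) * fps_nth g (Suc n) = B (Suc n) * fps_nth g n)"
  proof -
    have "D_op a b q t f = fps_const (a + b) * f \<longleftrightarrow>
        (\<forall>k. fps_nth (D_op a b q t f - fps_const (a + b) * f) k = 0)"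
      by (simp add: fps_eq_iff)
    also have "\<dots> \<longleftrightarrow> (\<forall>n. A (Suc n) * fps_nth g (Suc n) = B (Suc n) * fps_nth g n)"
      unfolding diff by (metis Suc_pred' diff_Suc_1 eq_iff_diff_eq_0 nat.distinct(1) neq0_conv)
    finally show ?thesis
      unfolding is_first_eigenfunction_def by (simp add: f_eq)
  qed
  also have "\<dots> \<longleftrightarrow> g = Abs_fps c"
  proof
    assume *: "fps_nth g 0 = 1 \<and> (\<forall>n. A (Suc n) * fps_nth g (Suc n) = B (Suc n) * fps_nth g n)"
    have "fps_nth g k = c k" for k
    proof (induction k)
      case 0
      then show ?case using * by (simp add: c_def qpoch_def)
    next
      case (Suc n)
      have "A (Suc n) * fps_nth g (Suc n) = A (Suc n) * c (Suc n)"
        using * Suc c_Suc by simp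
      then show ?case using A_nz[of "Suc n"] by simp
    qed
    then show "g = Abs_fps c" by (simp add: fps_eq_iff)
  next
    assume "g = Abs_fps c"
    then show "fps_nth g 0 = 1 \<and> (\<forall>n. A (Suc n) * fps_nth g (Suc n) = B (Suc n) * fps_nth g n)"
      using c_Suc by (simp add: c_def qpoch_def)
  qed
  also have "\<dots> \<longleftrightarrow> f = explicit_series a b q t"
  proof -
    have "(1 - fps_X :: 'k fps) \<noteq> 0"
      by (metis diff_zero fps_X_nth fps_one_nth fps_sub_nth fps_zero_nth zero_neq_one)
    then show ?thesis
      by (simp add: f_eq explicit_series_def c_def)
  qed
  finally show ?thesis .
qed

lemma first_eigenfunction_explicit:
  fixes a b q t :: "'k::field"
  assumes "q \<noteq> 0" "t \<noteq> 0" "b \<noteq> 0"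
    and "\<And>k. k > 0 \<Longrightarrow> q ^ k \<noteq> 1"
    and "\<And>k. k > 0 \<Longrightarrow> b \<noteq> q ^ k * a"
  shows "\<exists>!f. is_first_eigenfunction a b q t f"
    and "first_eigenfunction a b q t = explicit_series a b q t"
  using is_first_eigenfunction_iff[of q t b a, OF assms(1-3)] assms(4,5)
  by (auto simp: first_eigenfunction_def)

end

theory Submission
  imports Defs
begin

(* With n = m - 1 and t = q^m the coefficients c_k of the eigenfunction divided by 1 - x vanish
   for k > n, and collecting the powers of q brings them to the form
     c_k = [n choose k]_q q^(-k(n-k)) prod_{n-k < j <= n} (s1 - q^j s2) / prod_{1 <= j <= k} (s2 - q^j s1).
   All factors but the last quotient are invariant under k -> n - k, and under this substitution
   combined with s1 <-> s2 the last quotient changes exactly by the prefactor of pi_m(sigma_1).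
   The sign comes from the factor zeta1 - zeta2. *)

section \<open>Exchanging the variables of the coefficient field\<close>

text \<open>The lemmas from here to \<open>swap_s_prod\<close> establish that \<open>swap_s\<close>
  is a field homomorphism, so that it can be pushed through the products and quotients in
  \<open>eigen_coeff\<close>. Sums and products are checked on representing fractions, where
  \<open>swap_vars\<close> is additive and multiplicative; the other rules follow
  algebraically.\<close>

lemma swap_s_add: "swap_s (x + y) = swap_s x + swap_s (y :: 'a::field ratfun)"
proof -
  have add: "swap_vars (\<lambda>c. c) (p + r) = swap_vars (\<lambda>c. c) p + swap_vars (\<lambda>c. c) r"
    for p r :: "'a poly poly"
    by (intro poly_eqI) (simp add: coeff_swap_vars)
  show ?thesis
    by (cases x; cases y) (simp add: swap_s_Fract swap_vars_id_eq_0_iff swap_vars_id_mult add)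
qed

lemma swap_s_mult: "swap_s (x * y) = swap_s x * swap_s (y :: 'a::field ratfun)"
  by (cases x; cases y) (simp add: swap_s_Fract swap_vars_id_mult)

lemma swap_s_to_fract: "swap_s (to_fract p) = to_fract (swap_vars (\<lambda>c. c) p)"
proof -
  have "swap_vars (\<lambda>c. c) (1 :: 'a poly poly) = 1"
    by (intro poly_eqI) (simp add: coeff_swap_vars coeff_1)
  then show ?thesis
    by (simp add: to_fract_def swap_s_Fract)
qed

lemma swap_s_0 [simp]: "swap_s (0 :: 'a::field ratfun) = 0"
  using swap_s_add[of 0 "0 :: 'a ratfun"] by (metis add.right_neutral add_left_cancel)

lemma swap_s_scalar: "swap_s (scalar c) = scalar c"
proof -
  have "swap_vars (\<lambda>c. c) (const2 c) = const2 c"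
    by (intro poly_eqI) (simp add: coeff_swap_vars const2_def coeff_pCons split: nat.splits)
  then show ?thesis by (simp add: scalar_def swap_s_to_fract)
qed

lemma swap_s_1 [simp]: "swap_s (1 :: 'a::field ratfun) = 1"
  using swap_s_scalar[of "1 :: 'a"] by (simp add: scalar_def const2_def flip: one_pCons)

lemma swap_s_uminus: "swap_s (- x) = - swap_s (x :: 'a::field ratfun)"
  using swap_s_add[of x "- x"] by (simp add: eq_neg_iff_add_eq_0 add.commute)

lemma swap_s_diff: "swap_s (x - y) = swap_s x - swap_s (y :: 'a::field ratfun)"
  using swap_s_add[of x "- y"] by (simp add: swap_s_uminus)

lemma swap_s_inverse: "swap_s (inverse x) = inverse (swap_s (x :: 'a::field ratfun))"
proof (cases "x = 0")
  case False
  then have "swap_s x * swap_s (inverse x) = 1"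
    by (simp flip: swap_s_mult)
  then show ?thesis by (metis inverse_unique)
qed simp

lemma swap_s_divide: "swap_s (x / y) = swap_s x / swap_s (y :: 'a::field ratfun)"
  by (simp add: divide_inverse swap_s_mult swap_s_inverse)

lemma swap_s_power: "swap_s (x ^ k) = swap_s (x :: 'a::field ratfun) ^ k"
  by (induction k) (simp_all add: swap_s_mult)

lemma swap_s_prod: "swap_s (prod f A) = (\<Prod>x\<in>A. swap_s (f x :: 'a::field ratfun))"
  by (induction A rule: infinite_finite_induct) (simp_all add: swap_s_mult)

lemma swap_s_s1: "swap_s s1 = (s2 :: 'a::field ratfun)"
proof -
  have "swap_vars (\<lambda>c. c) var1 = (var2 :: 'a poly poly)"
    by (intro poly_eqI)
      (simp add: coeff_swap_vars var1_def var2_def coeff_pCons split: nat.splits)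
  then show ?thesis by (simp add: s1_def s2_def swap_s_to_fract)
qed

lemma swap_s_s2: "swap_s s2 = (s1 :: 'a::field ratfun)"
proof -
  have "swap_vars (\<lambda>c. c) var2 = (var1 :: 'a poly poly)"
    by (intro poly_eqI)
      (simp add: coeff_swap_vars var1_def var2_def coeff_pCons split: nat.splits)
  then show ?thesis by (simp add: s1_def s2_def swap_s_to_fract)
qed

lemma scalar_power: "scalar c ^ k = scalar (c ^ k)"
  by (induction k) (simp_all add: scalar_def const2_def flip: one_pCons to_fract_mult)

lemma scalar_eq_iff: "scalar c = scalar d \<longleftrightarrow> c = d"
  by (simp add: scalar_def const2_def)

text \<open>Since powers of \<open>scalar q\<close> are again scalars, this supplies the genericity
  condition on \<open>s1\<close> and \<open>s2\<close>. The embedding \<open>to_fract\<close> is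
  injective, and \<open>var2\<close> has degree 1 in the outer variable, in which
  \<open>const2 c * var1\<close> is constant.\<close>

lemma s2_neq_scalar_s1: "s2 \<noteq> scalar c * (s1 :: 'a::field ratfun)"
  by (simp add: s1_def s2_def scalar_def const2_def var1_def var2_def flip: to_fract_mult)

lemma s1_neq_scalar_s2: "s1 \<noteq> scalar c * (s2 :: 'a::field ratfun)"
proof
  assume "s1 = scalar c * (s2 :: 'a ratfun)"
  then have "swap_s s1 = swap_s (scalar c * (s2 :: 'a ratfun))" by simp
  then show False
    by (simp add: swap_s_mult swap_s_scalar swap_s_s1 swap_s_s2 s2_neq_scalar_s1)
qed


section \<open>The terminating eigenfunction\<close>

text \<open>For nonzero \<open>a\<close> this is \<open>a ^ k * qpoch (q * b / a) q k\<close>, and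
  \<open>qprod q 1 1 k\<close> is \<open>qpoch q q k\<close>. The homogeneous form makes the
  exchange of \<open>a\<close> and \<open>b\<close> a mere swap of arguments.\<close>

definition qprod :: "'k::field \<Rightarrow> 'k \<Rightarrow> 'k \<Rightarrow> nat \<Rightarrow> 'k" where
  "qprod q a b k = (\<Prod>j = 1..k. a - q ^ j * b)"

lemma qprod_0 [simp]: "qprod q a b 0 = 1"
  by (simp add: qprod_def)

lemma qprod_Suc: "qprod q a b (Suc k) = qprod q a b k * (a - q ^ Suc k * b)"
  by (simp add: qprod_def)

lemma qprod_nonzero:
  assumes "\<And>k. k > 0 \<Longrightarrow> a \<noteq> q ^ k * b"
  shows "qprod q a b k \<noteq> 0"
  using assms by (auto simp: qprod_def)

text \<open>The product over n - k < j <= n is written as the quotient of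
  \<open>qprod q a b n\<close> by \<open>qprod q a b (n - k)\<close>, which makes the denominator
  symmetric under k -> n - k combined with a <-> b.\<close>

definition eigen_coeff :: "'k::field \<Rightarrow> 'k \<Rightarrow> 'k \<Rightarrow> nat \<Rightarrow> nat \<Rightarrow> 'k" where
  "eigen_coeff q a b n k =
     qprod q 1 1 n / (qprod q 1 1 k * qprod q 1 1 (n - k)) / q ^ (k * (n - k))
       * (qprod q a b n / (qprod q a b (n - k) * qprod q b a k))"

text \<open>This is the term ratio of the explicit series at t = q^(n+1), where \<open>u\<close> is
  q/t = q^(-n). The number \<open>d\<close> encodes k < n without subtraction. In terms of x =
  q^(k+1) and y = q^(n-k), both ratios become (1-y)(a-yb)x / ((1-x)(b-xa)y).\<close>

lemma eigen_coeff_Suc: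
  fixes q a b :: "'k::field"
  assumes "q \<noteq> 0" "b \<noteq> 0"
    and q: "\<And>k. k > 0 \<Longrightarrow> q ^ k \<noteq> 1"
    and ba: "\<And>k. k > 0 \<Longrightarrow> b \<noteq> q ^ k * a"
    and ab: "\<And>k. k > 0 \<Longrightarrow> a \<noteq> q ^ k * b"
    and n: "n = Suc (k + d)"
  defines "u \<equiv> q * inverse (q ^ Suc n)"
  shows "eigen_coeff q a b n (Suc k) = eigen_coeff q a b n k *
      ((1 - u * q ^ k) * (1 - u * a / b * q ^ k)
        / ((1 - q * q ^ k) * (1 - q * a / b * q ^ k)) * q ^ Suc n)"
proof -
  define x where "x = q ^ Suc k"
  define y where "y = q ^ Suc d"
  have xy: "x \<noteq> 0" "y \<noteq> 0" using \<open>q \<noteq> 0\<close> by (simp_all add: x_def y_def)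
  have nz: "1 - x \<noteq> 0" "1 - y \<noteq> 0" "b - x * a \<noteq> 0" "a - y * b \<noteq> 0"
    using q[of "Suc k"] q[of "Suc d"] ba[of "Suc k"] ab[of "Suc d"]
    by (simp_all add: x_def y_def)
  have uk: "u * q ^ k = inverse y"
    using \<open>q \<noteq> 0\<close> by (simp add: u_def n y_def field_simps power_add)
  have "(1 - u * q ^ k) * (1 - u * a / b * q ^ k)
        / ((1 - q * q ^ k) * (1 - q * a / b * q ^ k)) * q ^ Suc n
      = (1 - inverse y) * (1 - inverse y * a / b) / ((1 - x) * (1 - x * a / b)) * (x * y)"
  proof -
    have "u * a / b * q ^ k = inverse y * a / b" using uk by (simp add: mult_ac flip: uk)
    moreover have "q * a / b * q ^ k = x * a / b" "q * q ^ k = x" "q ^ Suc n = x * y"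
      by (simp_all add: x_def y_def n power_add mult_ac)
    ultimately show ?thesis using uk by (simp only:)
  qed
  also have "\<dots> = (1 - y) * (a - y * b) / ((1 - x) * (b - x * a)) * (x / y)"
  proof -
    have "(1 - inverse y) * (1 - inverse y * a / b) = (1 - y) * (a - y * b) / (y * y * b)"
      using xy \<open>b \<noteq> 0\<close> by (simp add: field_simps)
    moreover have "1 - x * a / b = (b - x * a) / b"
      using \<open>b \<noteq> 0\<close> by (simp add: field_simps)
    ultimately show ?thesis using xy nz \<open>b \<noteq> 0\<close> by (simp add: divide_simps)
  qed
  finally have ratio: "(1 - u * q ^ k) * (1 - u * a / b * q ^ k)
        / ((1 - q * q ^ k) * (1 - q * a / b * q ^ k)) * q ^ Suc n
      = (1 - y) * (a - y * b) / ((1 - x) * (b - x * a)) * (x / y)" .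
  \<comment> \<open>The exponent k(n - k) grows by d - k, which matches x/y = q^(k-d).\<close>
  have qp: "1 / q ^ (Suc k * d) = 1 / q ^ (k * Suc d) * (x / y)"
    using \<open>q \<noteq> 0\<close> by (simp add: x_def y_def field_simps power_add)
  have nzp: "qprod q 1 1 j \<noteq> 0" "qprod q a b j \<noteq> 0" "qprod q b a j \<noteq> 0" for j
    using q ba ab qprod_nonzero[of 1 q 1] qprod_nonzero[of a q b] qprod_nonzero[of b q a]
    by (metis mult.right_neutral)+
  have *: "n - k = Suc d" "n - Suc k = d" by (simp_all add: n)
  \<comment> \<open>Only \<open>1 - y\<close> and \<open>a - y * b\<close> have to be cancelled, so
    the long products can be replaced by arbitrary field elements.\<close>
  have alg: "Q / (Q1 * (1 - x) * Q2) * w' * (A / (A1 * (B * (b - x * a))))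
      = Q / (Q1 * (Q2 * (1 - y))) * w * (A / (A1 * (a - y * b) * B))
        * ((1 - y) * (a - y * b) / ((1 - x) * (b - x * a)) * z)"
    if "w' = w * z" for Q Q1 Q2 A A1 B w w' z
    using nz that by (simp add: mult_ac)
  show ?thesis
    unfolding ratio eigen_coeff_def * qprod_Suc mult_1_right
      x_def[symmetric] y_def[symmetric]
    using alg[OF qp, of "qprod q 1 1 n" "qprod q 1 1 k" "qprod q 1 1 d" "qprod q a b n"
        "qprod q a b d" "qprod q b a k"]
    by (simp add: mult_ac)
qed

text \<open>For k <= n both sequences start with 1 and have the same term ratio. For k > n the
  symbol \<open>qpoch u q k\<close> contains the factor 1 - u q^n, which is zero because u =
  q^(-n).\<close>

lemma explicit_series_terminating:
  fixes q a b :: "'k::field"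
  assumes "q \<noteq> 0" "b \<noteq> 0"
    and q: "\<And>k. k > 0 \<Longrightarrow> q ^ k \<noteq> 1"
    and ba: "\<And>k. k > 0 \<Longrightarrow> b \<noteq> q ^ k * a"
    and ab: "\<And>k. k > 0 \<Longrightarrow> a \<noteq> q ^ k * b"
  shows "explicit_series a b q (q ^ Suc n)
    = (1 - fps_X) * Abs_fps (\<lambda>k. if k \<le> n then eigen_coeff q a b n k else 0)"
proof -
  define u where "u = q * inverse (q ^ Suc n)"
  define c where "c = (\<lambda>k. qpoch u q k * qpoch (u * a / b) q k
        / (qpoch q q k * qpoch (q * a / b) q k) * (q ^ Suc n) ^ k)"
  have qp: "qpoch x q (Suc k) = qpoch x q k * (1 - x * q ^ k)" for x k
    by (simp add: qpoch_def)
  have "c k = (if k \<le> n then eigen_coeff q a b n k else 0)" for k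
  proof (cases "k \<le> n")
    case True
    then have "c k = eigen_coeff q a b n k"
    proof (induction k)
      case 0
      have "qprod q 1 1 n \<noteq> 0" "qprod q a b n \<noteq> 0"
        using q ab by (auto intro!: qprod_nonzero)
      then show ?case by (simp add: c_def qpoch_def eigen_coeff_def)
    next
      case (Suc k)
      then obtain d where n: "n = Suc (k + d)" by (metis Suc_le_lessD less_imp_Suc_add)
      have "c (Suc k) = c k * ((1 - u * q ^ k) * (1 - u * a / b * q ^ k)
        / ((1 - q * q ^ k) * (1 - q * a / b * q ^ k)) * q ^ Suc n)"
        unfolding c_def qp power_Suc[of "q ^ Suc n"] times_divide_times_eq[symmetric]
        by (simp only: mult_ac times_divide_eq_left times_divide_eq_right divide_divide_eq_left)
      with Suc show ?case
        using eigen_coeff_Suc[OF assms(1,2) q ba ab n] by (simp add: u_def)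
    qed
    with True show ?thesis by simp
  next
    case False
    have "1 - u * q ^ n = 0" using \<open>q \<noteq> 0\<close> by (simp add: u_def field_simps)
    then have "qpoch u q k = 0" using False unfolding qpoch_def by (intro prod_zero) auto
    with False show ?thesis by (simp add: c_def)
  qed
  then show ?thesis by (simp add: explicit_series_def c_def u_def)
qed

text \<open>The denominators \<open>qprod q a b (n - k)\<close> and \<open>qprod q b a k\<close>
  trade places, and the q-binomial and the power of q are symmetric. Only the numerator
  \<open>qprod q b a n\<close> differs, and the prefactor replaces it by
  \<open>qprod q a b n\<close>.\<close>

lemma eigen_coeff_reflect:
  fixes q a b :: "'k::field"
  assumes "\<And>k. k > 0 \<Longrightarrow> b \<noteq> q ^ k * a"
    and "\<And>k. k > 0 \<Longrightarrow> a \<noteq> q ^ k * b"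
    and "k \<le> n"
  shows "qprod q a b n / qprod q b a n * eigen_coeff q b a n (n - k) = eigen_coeff q a b n k"
proof -
  have "qprod q a b j \<noteq> 0" "qprod q b a j \<noteq> 0" for j
    using assms by (auto intro!: qprod_nonzero)
  then show ?thesis
    using \<open>k \<le> n\<close> by (simp add: eigen_coeff_def mult_ac)
qed

lemma swap_s_eigen_coeff:
  "swap_s (eigen_coeff (scalar q) s1 s2 n k) = eigen_coeff (scalar q) s2 s1 n k"
  by (simp add: eigen_coeff_def qprod_def swap_s_mult swap_s_divide swap_s_power swap_s_prod
      swap_s_diff swap_s_scalar swap_s_s1 swap_s_s2)


section \<open>Homogenization\<close>

text \<open>This is zeta1^m f(zeta2/zeta1) with \<open>f\<close> truncated after degree
  \<open>m\<close>: the inner exponent belongs to zeta1, the outer one to zeta2.\<close>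

definition homogenize :: "nat \<Rightarrow> 'k::field fps \<Rightarrow> 'k poly poly" where
  "homogenize m f = (\<Sum>j\<le>m. monom (monom (fps_nth f j) (m - j)) j)"

lemma coeff_homogenize:
  "coeff (homogenize m f) j = (if j \<le> m then monom (fps_nth f j) (m - j) else 0)"
  by (simp add: homogenize_def coeff_sum)

text \<open>Equality of series needs the entire Laurent coefficient of zeta2^j, whereas
  \<open>coeff_poly_to_series2\<close> sees only the nonnegative powers of zeta1.\<close>

lemma fps_nth_poly_to_series2:
  "fps_nth (poly_to_series2 p) j = poly (map_poly fls_const (coeff p j)) fls_X_inv"
proof (induction p arbitrary: j)
  case 0
  then show ?case by (simp add: poly_to_series2_def)
next
  case (pCons a p)
  have "poly (map_poly (\<lambda>c. fps_const (fls_const c)) a) zeta1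
      = fps_const (poly (map_poly fls_const a) fls_X_inv)"
    by (induction a) (simp_all add: map_poly_pCons zeta1_def)
  moreover have "poly_to_series2 (pCons a p)
      = poly (map_poly (\<lambda>c. fps_const (fls_const c)) a) zeta1 + zeta2 * poly_to_series2 p"
    by (simp add: poly_to_series2_def subst2_pCons)
  ultimately show ?case
    using pCons by (cases j) (simp_all add: zeta2_def)
qed

lemma poly_to_series2_homogenize:
  fixes f :: "'k::field fps"
  assumes "\<And>j. j > m \<Longrightarrow> fps_nth f j = 0"
  shows "poly_to_series2 (homogenize m f) = zeta1 ^ m * ratio_series f"
proof (rule fps_ext)
  fix j
  have "fls_X_inv ^ m * fls_X ^ j = (fls_X_inv :: 'k fls) ^ (m - j)" if "j \<le> m"
  proof -
    have "fls_X_inv ^ j * fls_X ^ j = (1 :: 'k fls)"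
      by (simp add: fls_X_inv_times_conv_shift flip: power_mult_distrib)
    then show ?thesis
      using that by (metis le_add_diff_inverse2 mult.assoc mult.right_neutral power_add)
  qed
  then show "fps_nth (poly_to_series2 (homogenize m f)) j = fps_nth (zeta1 ^ m * ratio_series f) j"
    using assms[of j]
    by (cases "j \<le> m")
      (simp_all add: fps_nth_poly_to_series2 coeff_homogenize map_poly_monom poly_monom zeta1_def
        ratio_series_nth fps_const_power mult.left_commute)
qed

theorem proposition3p4:
  fixes q :: "'a::field" and m :: nat
  assumes "q \<noteq> 0" and "\<And>k::nat. k > 0 \<Longrightarrow> q ^ k \<noteq> 1" and "m > 0"
  shows "\<exists>P :: 'a polyspace.
           poly_to_series2 P
             = zeta1 ^ m * ratio_series (first_eigenfunction s1 s2 (scalar q) (scalar q ^ m))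
           \<and> pi_sigma1 q m P = - P"
proof -
  \<comment> \<open>The quotient of the eigenfunction by 1 - x has degree at most n = m - 1; the
    factor 1 - x raises this bound to m.\<close>
  obtain n where m: "m = Suc n" using \<open>m > 0\<close> by (metis gr0_implies_Suc)
  define Q where "Q = scalar q"
  have Q0: "Q \<noteq> 0" using \<open>q \<noteq> 0\<close> by (simp add: Q_def scalar_def const2_def)
  have s2: "s2 \<noteq> (0 :: 'a ratfun)" by (simp add: s2_def var2_def)
  have Q1: "Q ^ k \<noteq> 1" if "k > 0" for k
    using assms(2)[OF that] scalar_eq_iff[of "q ^ k" 1]
    by (simp add: Q_def scalar_power) (simp add: scalar_def const2_def flip: one_pCons)
  have s21: "s2 \<noteq> Q ^ k * s1" and s12: "s1 \<noteq> Q ^ k * s2" for k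
    unfolding Q_def scalar_power by (rule s2_neq_scalar_s1 s1_neq_scalar_s2)+
  \<comment> \<open>The arguments \<open>a\<close> and \<open>b\<close> stay free because
    \<open>swap_s\<close> exchanges them. The cutoff value 0 beyond \<open>n\<close> supplies the
    boundary terms in \<open>anti\<close>.\<close>
  define c where "c = (\<lambda>a b k. if k \<le> n then eigen_coeff Q a b n k else 0)"
  define f where "f = (1 - fps_X) * Abs_fps (c s1 s2)"
  have f: "first_eigenfunction s1 s2 Q (Q ^ m) = f"
    using first_eigenfunction_explicit(2)[of Q "Q ^ m" s2 s1]
      explicit_series_terminating[of Q s2 s1 n] Q0 Q1 s2 s21 s12
    by (simp add: f_def c_def m)
  \<comment> \<open>At j = 0 the subtraction \<open>j - 1\<close> would give 0 again, hence the case
    distinction.\<close>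
  have f_nth: "fps_nth f j = c s1 s2 j - (if j = 0 then 0 else c s1 s2 (j - 1))" for j
    by (simp add: f_def left_diff_distrib)
  have "fps_nth f j = 0" if "j > m" for j
    using that by (auto simp: f_nth c_def m)
  then have "poly_to_series2 (homogenize m f) = zeta1 ^ m * ratio_series f"
    by (rule poly_to_series2_homogenize)
  moreover have "pi_sigma1 q m (homogenize m f) = - homogenize m f"
  proof (intro poly_eqI)
    fix i j
    define C where "C = qprod Q s1 s2 n / qprod Q s2 s1 n"
    have C: "(\<Prod>k = 1..m - 1. (s1 - scalar q ^ k * s2) / (s2 - scalar q ^ k * s1)) = C"
      by (simp add: C_def qprod_def m Q_def prod_dividef)
    have swap_c: "swap_s (c s1 s2 k) = c s2 s1 k" for k
      by (simp add: c_def Q_def swap_s_eigen_coeff)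
    have reflect: "C * c s2 s1 (n - k) = c s1 s2 k" if "k \<le> n" for k
      using eigen_coeff_reflect[of s2 Q s1 k n] s21 s12 that by (simp add: C_def c_def)
    \<comment> \<open>The coefficient of \<open>f\<close> at k is c_k - c_(k-1). Reflection about n
      sends the two terms at m - k to c_(k-1) and c_k, so their difference changes sign. At k = 0
      and k = m one term is missing, and the cutoff makes its partner vanish.\<close>
    have anti: "C * swap_s (fps_nth f (m - k)) = - fps_nth f k" if "k \<le> m" for k
    proof -
      have "C * swap_s (fps_nth f (m - k))
          = C * c s2 s1 (m - k) - (if k = m then 0 else C * c s2 s1 (n - k))"
        using that by (auto simp: f_nth swap_s_diff swap_c right_diff_distrib m Suc_diff_le)
      also have "C * c s2 s1 (m - k) = (if k = 0 then 0 else c s1 s2 (k - 1))"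
        using that reflect[of "k - 1"] by (cases k) (simp_all add: m c_def)
      also have "(if k = m then 0 else C * c s2 s1 (n - k)) = c s1 s2 k"
        using that reflect[of k] by (auto simp: m c_def)
      finally show ?thesis by (simp add: f_nth)
    qed
    have "coeff (coeff (pi_sigma1 q m (homogenize m f)) j) i
        = C * swap_s (coeff (coeff (homogenize m f) i) j)"
      unfolding pi_sigma1_def C by (simp add: const2_def coeff_swap_vars)
    \<comment> \<open>By homogeneity only i + j = m contributes, and then i = m - j, so
      \<open>anti\<close> compares the coefficients at opposite positions.\<close>
    also have "\<dots> = (if i + j = m then C * swap_s (fps_nth f (m - j)) else 0)"
      by (auto simp: coeff_homogenize coeff_monom)
    also have "\<dots> = coeff (coeff (- homogenize m f) j) i"
      using anti[of j] by (auto simp: coeff_homogenize coeff_monom)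
    finally show "coeff (coeff (pi_sigma1 q m (homogenize m f)) j) i
        = coeff (coeff (- homogenize m f) j) i" .
  qed
  ultimately show ?thesis using f by (auto simp: Q_def)
qed

end
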